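(* Let $q$ be an odd prime power. If $G$ is the incidence graph of the algebraic projective plane $PG(2,q)$ of order $q$, then $$q^2+q+1\le h(G)\le q^2+q+2.$$
   Context: A harmonious $k$-coloring of a finite simple graph $G$ is a proper vertex coloring with $k$ colors such that every (unordered) pair of colors appears on at most one edge. The harmonious chromatic number $h(G)$ is the minimum $k$ such that $G$ has a harmonious $k$-coloring. The algebraic projective plane $PG(2,q)$ is the Desarguesian projective plane over the finite field $GF(q)$. The incidence graph (Levi graph) of a projective plane is the bipartite graph whose vertices are the $q^2+q+1$ points and the $q^2+q+1$ lines, a point and a line being adjacent if and only if they are incident. *)

theory Defs
  imports
    "HOL-Library.Ramsey"
    "HOL-Library.Numeral_Type"
    "HOL-Analysis.Cartesian_Space"
    "HOL-Number_Theory.Prime_Powers"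
begin

section \<open>Finite simple graphs and harmonious colorings\<close>

text \<open>A graph is a pair of a vertex set and a set of two-element sets of vertices.\<close>

type_synonym 'v sgraph = "'v set \<times> 'v set set"

abbreviation verts :: "'v sgraph \<Rightarrow> 'v set" where
  "verts G \<equiv> fst G"

abbreviation edges :: "'v sgraph \<Rightarrow> 'v set set" where
  "edges G \<equiv> snd G"

definition finite_simple_graph :: "'v sgraph \<Rightarrow> bool" where
  "finite_simple_graph G \<longleftrightarrow> finite (verts G) \<and> edges G \<subseteq> [verts G]\<^bsup>2\<^esup>"

definition proper_coloring :: "'v sgraph \<Rightarrow> nat \<Rightarrow> ('v \<Rightarrow> nat) \<Rightarrow> bool" where
  "proper_coloring G k c \<longleftrightarrow>
     c ` verts G \<subseteq> {..<k} \<and> (\<forall>u v. {u, v} \<in> edges G \<longrightarrow> c u \<noteq> c v)"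

text \<open>The unordered pair of colors appearing on an edge \<open>e\<close> is the image \<open>c ` e\<close>.\<close>

definition harmonious_coloring :: "'v sgraph \<Rightarrow> nat \<Rightarrow> ('v \<Rightarrow> nat) \<Rightarrow> bool" where
  "harmonious_coloring G k c \<longleftrightarrow>
     proper_coloring G k c \<and>
     (\<forall>e \<in> edges G. \<forall>f \<in> edges G. c ` e = c ` f \<longrightarrow> e = f)"

definition harmonious_number :: "'v sgraph \<Rightarrow> nat" where
  "harmonious_number G = (LEAST k. \<exists>c. harmonious_coloring G k c)"

text \<open>The minimum is attained for every finite simple graph: color all vertices differently.\<close>

lemma harmonious_number_attained:
  assumes "finite_simple_graph G"
  shows "\<exists>c. harmonious_coloring G (harmonious_number G) c"
proof -
  have fin: "finite (verts G)" and sub: "edges G \<subseteq> [verts G]\<^bsup>2\<^esup>"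
    using assms by (auto simp: finite_simple_graph_def)
  obtain c where c: "bij_betw c (verts G) {..<card (verts G)}"
    using ex_bij_betw_finite_nat[OF fin] by (auto simp: atLeast0LessThan)
  have inj: "inj_on c (verts G)"
    using c by (simp add: bij_betw_def)
  have in_verts: "e \<subseteq> verts G" if "e \<in> edges G" for e
    using sub that by (auto simp: nsets_def)
  have "proper_coloring G (card (verts G)) c"
    unfolding proper_coloring_def
  proof (intro conjI allI impI)
    show "c ` verts G \<subseteq> {..<card (verts G)}"
      using c by (simp add: bij_betw_def)
  next
    fix u v assume "{u, v} \<in> edges G"
    then have "{u, v} \<in> [verts G]\<^bsup>2\<^esup>"
      using sub by blast
    then show "c u \<noteq> c v"
      using inj by (auto simp: inj_on_def)
  qed
  moreover have "e = f" if "e \<in> edges G" "f \<in> edges G" "c ` e = c ` f" for e f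
    using inj_on_image_eq_iff[OF inj in_verts in_verts] that by blast
  ultimately have "harmonious_coloring G (card (verts G)) c"
    by (auto simp: harmonious_coloring_def)
  then have "\<exists>k c. harmonious_coloring G k c"
    by blast
  then show ?thesis
    unfolding harmonious_number_def by (rule LeastI_ex)
qed

section \<open>Incidence graphs and the plane PG(2,q)\<close>

definition incidence_graph ::
  "'p set \<Rightarrow> 'l set \<Rightarrow> ('p \<Rightarrow> 'l \<Rightarrow> bool) \<Rightarrow> ('p + 'l) sgraph" where
  "incidence_graph P L I =
     (Inl ` P \<union> Inr ` L, {{Inl p, Inr l} | p l. p \<in> P \<and> l \<in> L \<and> I p l})"

lemma finite_simple_graph_incidence_graph:
  assumes "finite P" "finite L"
  shows "finite_simple_graph (incidence_graph P L I)"
  using assms by (auto simp: finite_simple_graph_def incidence_graph_def)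

text \<open>For a finite field \<open>'a\<close> of order \<open>q\<close>, the points and lines of PG(2,q) are the
  one- and two-dimensional linear subspaces of the three-dimensional vector space over
  \<open>'a\<close>, and incidence is inclusion.\<close>

definition PG2_points :: "('a::field ^ 3) set set" where
  "PG2_points = {U. vec.subspace U \<and> vec.dim U = 1}"

definition PG2_lines :: "('a::field ^ 3) set set" where
  "PG2_lines = {U. vec.subspace U \<and> vec.dim U = 2}"

definition PG2_incidence_graph :: "(('a::field ^ 3) set + ('a ^ 3) set) sgraph" where
  "PG2_incidence_graph = incidence_graph PG2_points PG2_lines (\<subseteq>)"

lemma finite_simple_graph_PG2_incidence_graph:
  "finite_simple_graph
     (PG2_incidence_graph :: (('a::{field,finite} ^ 3) set + ('a ^ 3) set) sgraph)"
  unfolding PG2_incidence_graph_def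
  by (intro finite_simple_graph_incidence_graph) simp_all

end

theory Submission
  imports
    Defs
    "HOL-Analysis.Determinants"
    "HOL-Computational_Algebra.Polynomial_Factorial"
begin

text \<open>
  Let \<open>F\<close> be the field of order \<open>q\<close> and \<open>n = q\<^sup>2 + q + 1\<close>. Two points of the plane always
  lie on a common line. A harmonious coloring that gave them the same color would put the same pair
  of colors on their edges to that line, so all \<open>n\<close> points have different colors
  (\<open>harmonious_coloring_PG2_ge\<close>).

  Conversely \<open>n\<close> colors suffice (\<open>ex_harmonious_coloring\<close>), by the Singer model of the plane.
  Identify \<open>F\<^sup>3\<close> with a cubic extension field \<open>K\<close> of \<open>F\<close>. For a nonzero linear form \<open>\<lambda>\<close> on \<open>K\<close>,
  every line is \<open>{z. \<lambda> (z y) = 0}\<close> for some \<open>y \<noteq> 0\<close>, which is unique up to a factor from \<open>F\<close>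
  (\<open>line_as_kernel\<close> gives the existence). Give the \<open>n\<close> points distinct colors, fix \<open>e \<noteq> 0\<close> in \<open>K\<close>,
  and give the line of \<open>y\<close> the color of the point \<open>\<langle>e / y\<rangle>\<close>. Different lines then have
  different colors. So the only way in which two edges, from \<open>\<langle>z\<rangle>\<close> to the line of \<open>y\<close> and from
  \<open>\<langle>z'\<rangle>\<close> to the line of \<open>y'\<close>, can carry the same pair of colors is crosswise:
  \<open>\<langle>z\<rangle> = \<langle>e / y'\<rangle>\<close> and \<open>\<langle>z'\<rangle> = \<langle>e / y\<rangle>\<close>. In that case \<open>a = z y\<close> and
  \<open>b = z' y'\<close> lie in the kernel of \<open>\<lambda>\<close> and \<open>a b\<close> is a nonzero multiple of \<open>e\<^sup>2\<close>. An edge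
  with equal colors at both ends is the case where the two edges coincide.

  It remains to choose \<open>e\<close> such that no nonzero multiple of \<open>e\<^sup>2\<close> is a product of two elements of
  the kernel (\<open>ex_square_not_product\<close>). Let \<open>K = F(t)\<close> and let \<open>\<lambda>\<close> be the coefficient of \<open>t\<^sup>2\<close>.
  Products of two elements of the kernel are products of two polynomials in \<open>t\<close> of degree at
  most one, so a quadratic \<open>g\<close> in \<open>t\<close> that is irreducible over \<open>F\<close> is not such a product. Every
  point of the plane is spanned by a square of \<open>K\<close>, because squaring is injective on the finite set
  of points (\<open>square_injective_on_points\<close>); so \<open>e\<close> with \<open>\<langle>e\<^sup>2\<rangle> = \<langle>g\<rangle>\<close> exists.
\<close>

section \<open>Points and lines\<close>

lemma span_singleton_eq_iff:
  fixes x y :: "'a::field ^ 3"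
  assumes "x \<noteq> 0"
  shows "vec.span {x} = vec.span {y} \<longleftrightarrow> (\<exists>s. s \<noteq> 0 \<and> x = s *s y)"
proof
  assume "vec.span {x} = vec.span {y}"
  then have "x \<in> vec.span {y}"
    using vec.span_base[of x "{x}"] by simp
  then obtain s where "x = s *s y"
    by (auto simp: vec.span_singleton)
  then show "\<exists>s. s \<noteq> 0 \<and> x = s *s y"
    using assms by auto
next
  assume "\<exists>s. s \<noteq> 0 \<and> x = s *s y"
  then obtain s where s: "s \<noteq> 0" "x = s *s y"
    by blast
  show "vec.span {x} = vec.span {y}"
  proof
    show "vec.span {x} \<subseteq> vec.span {y}"
      using s by (auto simp: vec.span_singleton)
    have "y = inverse s *s x"
      using s by (simp add: vector_smult_assoc)
    then show "vec.span {y} \<subseteq> vec.span {x}"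
      by (auto simp: vec.span_singleton)
  qed
qed

lemma span_singleton_in_PG2_points:
  fixes x :: "'a::field ^ 3"
  assumes "x \<noteq> 0"
  shows "vec.span {x} \<in> PG2_points"
proof -
  have "vec.dim (vec.span {x}) = 1"
    using assms by (subst vec.dim_span, subst vec.dim_eq_card_independent) auto
  then show ?thesis
    by (simp add: PG2_points_def vec.subspace_span)
qed

lemma PG2_points_span:
  fixes U :: "('a::field ^ 3) set"
  assumes "U \<in> PG2_points"
  obtains x where "x \<noteq> 0" "U = vec.span {x}"
proof -
  have U: "vec.subspace U" "vec.dim U = 1"
    using assms by (auto simp: PG2_points_def)
  obtain B where B: "B \<subseteq> U" "vec.independent B" "U \<subseteq> vec.span B" "card B = 1"
    using vec.basis_exists[of U] U by metis
  obtain x where x: "B = {x}"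
    using B(4) by (auto simp: card_1_singleton_iff)
  show ?thesis
  proof
    show "x \<noteq> 0"
      using B(2) vec.dependent_zero[of B] x by auto
    show "U = vec.span {x}"
      using B U(1) x vec.span_minimal by blast
  qed
qed

lemma PG2_lines_span:
  fixes U :: "('a::field ^ 3) set"
  assumes "U \<in> PG2_lines"
  obtains u v where "U = vec.span {u, v}"
proof -
  have U: "vec.subspace U" "vec.dim U = 2"
    using assms by (auto simp: PG2_lines_def)
  obtain B where B: "B \<subseteq> U" "vec.independent B" "U \<subseteq> vec.span B" "card B = 2"
    using vec.basis_exists[of U] U by metis
  obtain u v where "B = {u, v}"
    using B(4) by (auto simp: card_2_iff)
  with that B U(1) vec.span_minimal show ?thesis
    by blast
qed

lemma two_points_on_line:
  fixes U V :: "('a::field ^ 3) set"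
  assumes "U \<in> PG2_points" "V \<in> PG2_points" "U \<noteq> V"
  obtains L where "L \<in> PG2_lines" "U \<subseteq> L" "V \<subseteq> L"
proof -
  obtain x where x: "x \<noteq> 0" "U = vec.span {x}"
    using assms(1) by (rule PG2_points_span)
  obtain y where y: "y \<noteq> 0" "V = vec.span {y}"
    using assms(2) by (rule PG2_points_span)
  have notin: "x \<notin> vec.span {y}"
    using assms(3) x y span_singleton_eq_iff[OF x(1), of y]
    by (auto simp: vec.span_singleton)
  then have ne: "x \<noteq> y"
    using vec.span_base by blast
  have "vec.independent {x, y}"
    using notin y(1) ne by (subst vec.independent_insert) auto
  then have "vec.dim (vec.span {x, y}) = 2"
    using ne by (subst vec.dim_span, subst vec.dim_eq_card_independent) auto
  then have "vec.span {x, y} \<in> PG2_lines"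
    by (simp add: PG2_lines_def vec.subspace_span)
  moreover have "U \<subseteq> vec.span {x, y}" "V \<subseteq> vec.span {x, y}"
    unfolding x y by (auto intro!: vec.span_mono)
  ultimately show ?thesis
    using that by blast
qed

text \<open>The points partition the \<open>q\<^sup>3 - 1\<close> nonzero vectors into classes of size \<open>q - 1\<close>.\<close>
lemma card_PG2_points:
  "card (PG2_points :: ('a::{field,finite} ^ 3) set set) = CARD('a)^2 + CARD('a) + 1"
proof -
  let ?q = "CARD('a)" and ?P = "PG2_points :: ('a ^ 3) set set"
  have q: "?q \<ge> 2"
    using card_mono[of "UNIV :: 'a set" "{0, 1}"] by simp
  have card_U: "card (U - {0}) = ?q - 1" if "U \<in> ?P" for U
  proof -
    obtain x where x: "x \<noteq> 0" "U = vec.span {x}"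
      using \<open>U \<in> ?P\<close> by (rule PG2_points_span)
    have "inj (\<lambda>s. s *s x)"
      using x(1) by (auto simp: inj_on_def)
    then have "card U = ?q"
      using x(2) by (simp add: vec.span_singleton card_image)
    moreover have "0 \<in> U"
      using x(2) by (simp add: vec.span_zero)
    ultimately show ?thesis
      by simp
  qed
  have union: "(\<Union>U\<in>?P. U - {0}) = UNIV - {0}"
  proof
    show "UNIV - {0} \<subseteq> (\<Union>U\<in>?P. U - {0})"
    proof
      fix x :: "'a ^ 3" assume "x \<in> UNIV - {0}"
      then show "x \<in> (\<Union>U\<in>?P. U - {0})"
        using span_singleton_in_PG2_points[of x] vec.span_base[of x "{x}"] by auto
    qed
  qed auto
  have disj: "(U - {0}) \<inter> (V - {0}) = {}"
    if "U \<in> ?P" "V \<in> ?P" "U \<noteq> V" for U V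
  proof (rule ccontr)
    assume "(U - {0}) \<inter> (V - {0}) \<noteq> {}"
    then obtain z where z: "z \<in> U" "z \<in> V" "z \<noteq> 0"
      by blast
    have "W = vec.span {z}" if W: "W \<in> ?P" "z \<in> W" for W
    proof -
      obtain x where x: "x \<noteq> 0" "W = vec.span {x}"
        using W(1) by (rule PG2_points_span)
      then obtain s where "z = s *s x"
        using W(2) by (auto simp: vec.span_singleton)
      then show ?thesis
        using x z(3) span_singleton_eq_iff[of z x] by auto
    qed
    with that z show False
      by blast
  qed
  have "?q ^ 3 - 1 = card (UNIV - {0 :: 'a ^ 3})"
    by simp
  also have "\<dots> = card (\<Union>U\<in>?P. U - {0})"
    by (simp only: union)
  also have "\<dots> = (\<Sum>U\<in>?P. card (U - {0}))"
    using disj by (intro card_UN_disjoint) auto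
  also have "\<dots> = card ?P * (?q - 1)"
    using card_U by simp
  finally have "card ?P * (?q - 1) = ?q ^ 3 - 1"
    by simp
  moreover have "(?q^2 + ?q + 1) * (?q - 1) = ?q ^ 3 - 1"
    by (cases ?q) (auto simp: power2_eq_square power3_eq_cube algebra_simps)
  ultimately have "card ?P * (?q - 1) = (?q^2 + ?q + 1) * (?q - 1)"
    by simp
  then show ?thesis
    using q by (simp only: mult_right_cancel[of "?q - 1"])
qed

section \<open>A cubic extension field\<close>

text \<open>This yields irreducible polynomials without counting them: \<open>x\<^sup>3 - x\<^sup>2\<close> takes the same value at
  \<open>0\<close> and \<open>1\<close>, and \<open>x\<^sup>2 + x\<close> at \<open>0\<close> and \<open>- 1\<close>, so each of them misses some constant. A polynomial of
  degree two or three without a root is irreducible.\<close>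
lemma finite_ex_not_in_range:
  fixes f :: "'a::finite \<Rightarrow> 'a"
  assumes "f u = f v" "u \<noteq> v"
  obtains c where "\<And>x. f x \<noteq> c"
  using assms finite_UNIV_surj_inj[of f] by (metis finite injD surj_def)

text \<open>The extension field is \<open>F[t] / (t\<^sup>3 - t\<^sup>2 - c)\<close>. It is written on \<open>F\<^sup>3\<close> in the basis
  \<open>1, t, t\<^sup>2\<close>, so that its elements are the vectors whose spans are the points of the plane.\<close>
locale cubic_extension =
  fixes c :: "'a::{field,finite}"
  assumes no_root: "x ^ 3 - x ^ 2 \<noteq> c"
begin

text \<open>Multiplication of polynomials in \<open>t\<close>, reduced by \<open>t\<^sup>3 = t\<^sup>2 + c\<close> and
  \<open>t\<^sup>4 = t\<^sup>2 + c t + c\<close>.\<close>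
definition mul :: "'a ^ 3 \<Rightarrow> 'a ^ 3 \<Rightarrow> 'a ^ 3" (infixl "\<odot>" 70) where
  "x \<odot> y = vector
     [x$1 * y$1 + c * (x$2 * y$3 + x$3 * y$2) + c * (x$3 * y$3),
      x$1 * y$2 + x$2 * y$1 + c * (x$3 * y$3),
      x$1 * y$3 + x$2 * y$2 + x$3 * y$1 + (x$2 * y$3 + x$3 * y$2) + x$3 * y$3]"

lemma mul_nth [simp]:
  "(x \<odot> y) $ 1 = x$1 * y$1 + c * (x$2 * y$3 + x$3 * y$2) + c * (x$3 * y$3)"
  "(x \<odot> y) $ 2 = x$1 * y$2 + x$2 * y$1 + c * (x$3 * y$3)"
  "(x \<odot> y) $ 3 = x$1 * y$3 + x$2 * y$2 + x$3 * y$1 + (x$2 * y$3 + x$3 * y$2) + x$3 * y$3"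
  by (simp_all add: mul_def)

lemma mul_commute: "x \<odot> y = y \<odot> x"
  by (simp add: vec_eq_iff forall_3 algebra_simps)

lemma mul_assoc: "(x \<odot> y) \<odot> z = x \<odot> (y \<odot> z)"
  by (simp add: vec_eq_iff forall_3 algebra_simps)

lemma mul_left_commute: "x \<odot> (y \<odot> z) = y \<odot> (x \<odot> z)"
  by (metis mul_assoc mul_commute)

lemma mul_add_left: "(x + y) \<odot> z = x \<odot> z + y \<odot> z"
  by (simp add: vec_eq_iff forall_3 algebra_simps)

lemma mul_diff_right: "x \<odot> (y - z) = x \<odot> y - x \<odot> z"
  by (simp add: vec_eq_iff forall_3 algebra_simps)

lemma mul_smult_left: "(s *s x) \<odot> y = s *s (x \<odot> y)"
  by (simp add: vec_eq_iff forall_3 algebra_simps)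

lemma mul_smult_right: "x \<odot> (s *s y) = s *s (x \<odot> y)"
  by (simp add: vec_eq_iff forall_3 algebra_simps)

lemma mul_zero [simp]: "0 \<odot> x = 0" "x \<odot> 0 = 0"
  by (simp_all add: vec_eq_iff forall_3)

definition modulus :: "'a poly" where
  "modulus = [:- c, 0, - 1, 1:]"

lemma irreducible_modulus: "irreducible modulus"
proof (rule irreducibleI)
  show "modulus \<noteq> 0"
    by (simp add: modulus_def)
  show "\<not> modulus dvd 1"
    by (auto simp: modulus_def is_unit_poly_iff)
  fix a b assume ab: "modulus = a * b"
  then have nz: "a \<noteq> 0" "b \<noteq> 0"
    by (auto simp: modulus_def)
  have deg: "degree a + degree b = 3"
  proof -
    have "degree (a * b) = 3"
      by (simp add: modulus_def flip: ab)
    then show ?thesis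
      using degree_mult_eq nz by metis
  qed
  have no_linear: "degree p \<noteq> 1" if "p dvd modulus" for p
  proof
    assume "degree p = 1"
    then obtain u v where p: "p = [:u, v:]" "v \<noteq> 0"
      by (metis degree1_coeffs)
    have "poly modulus (- u / v) = 0"
      using that p by (auto simp: dvd_def field_simps)
    then have "(- u / v) ^ 3 - (- u / v) ^ 2 = c"
      by (simp add: modulus_def power2_eq_square power3_eq_cube algebra_simps
          eq_neg_iff_add_eq_0 neg_eq_iff_add_eq_0)
    with no_root show False
      by blast
  qed
  have "degree a = 0 \<or> degree b = 0"
    using deg no_linear[of a] no_linear[of b] ab by fastforce
  then show "a dvd 1 \<or> b dvd 1"
    using nz by (auto simp: is_unit_iff_degree)
qed

text \<open>A vanishing product means that the irreducible modulus divides the product of two polynomials of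
  degree at most two. Hence it divides one of them, which is too small unless it is zero.\<close>
lemma mul_eq_0_imp:
  assumes "x \<odot> y = 0"
  shows "x = 0 \<or> y = 0"
proof -
  let ?p = "\<lambda>x :: 'a ^ 3. [:x$1, x$2, x$3:]"
  \<comment> \<open>The quotient collects the coefficients of \<open>t\<^sup>3\<close> and \<open>t\<^sup>4\<close> after one reduction step.\<close>
  have "?p x * ?p y = ?p (x \<odot> y)
      + modulus * [:x$2 * y$3 + x$3 * y$2 + x$3 * y$3, x$3 * y$3:]"
    by (simp add: modulus_def algebra_simps)
  moreover have "?p (x \<odot> y) = 0"
    using assms by (simp del: mul_nth)
  ultimately have "modulus dvd ?p x * ?p y"
    by (simp only: add_0_left dvd_triv_left)
  then have "modulus dvd ?p x \<or> modulus dvd ?p y"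
    by (rule prime_elem_dvd_multD[OF field_poly_irreducible_imp_prime[OF irreducible_modulus]])
  moreover have "z = 0" if "modulus dvd ?p z" for z
  proof -
    have "degree (?p z) < degree modulus"
      by (simp add: modulus_def)
    then have "?p z = 0"
      using that by (meson dvd_imp_degree_le leD)
    then show ?thesis
      by (simp add: vec_eq_iff forall_3)
  qed
  ultimately show ?thesis
    by blast
qed

lemma mul_left_cancel:
  assumes "x \<noteq> 0" "x \<odot> y = x \<odot> z"
  shows "y = z"
  using assms mul_eq_0_imp[of x "y - z"] by (simp add: mul_diff_right)

lemma division:
  assumes "x \<noteq> 0"
  obtains y where "x \<odot> y = z"
proof -
  have "inj ((\<odot>) x)"
    using mul_left_cancel[OF assms] by (auto simp: inj_def)
  then have "surj ((\<odot>) x)"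
    by (intro finite_UNIV_inj_surj) auto
  then show ?thesis
    using that by (metis surjD)
qed

section \<open>Squares in the extension field\<close>

text \<open>The field norm of the extension: a multiplicative map to \<open>F\<close> that is homogeneous of degree three.\<close>
definition nrm :: "'a ^ 3 \<Rightarrow> 'a" where
  "nrm x = det (matrix ((\<odot>) x))"

lemma linear_mul: "Vector_Spaces.linear (*s) (*s) ((\<odot>) x)"
  by unfold_locales (simp_all add: mul_smult_right mul_commute[of x] mul_add_left)

lemma nrm_mul: "nrm (x \<odot> y) = nrm x * nrm y"
proof -
  have "(\<odot>) (x \<odot> y) = (\<odot>) x \<circ> (\<odot>) y"
    by (auto simp: mul_assoc)
  then show ?thesis
    unfolding nrm_def by (simp only: matrix_compose_gen[OF linear_mul linear_mul] det_mul)
qed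

lemma nrm_smult: "nrm (s *s x) = s ^ 3 * nrm x"
  by (simp add: nrm_def det_3 matrix_def mul_smult_left power3_eq_cube
      algebra_simps del: mul_nth)

text \<open>The vector \<open>axis 1 1\<close> is the unit of the field.\<close>
lemma nrm_nonzero:
  assumes "x \<noteq> 0"
  shows "nrm x \<noteq> 0"
proof -
  obtain y where y: "x \<odot> y = axis 1 1"
    using assms by (rule division)
  have "nrm (axis 1 1) = 1"
    by (simp add: nrm_def det_3 matrix_def axis_def)
  with y show ?thesis
    by (metis mult_zero_left nrm_mul zero_neq_one)
qed

text \<open>The degree three is odd, and so a scalar of \<open>F\<close> that is a square in the extension is already a
  square in \<open>F\<close>: if \<open>x\<^sup>2 = s y\<^sup>2\<close>, taking norms gives \<open>N(x)\<^sup>2 = s\<^sup>3 N(y)\<^sup>2\<close>, whence \<open>s = w\<^sup>2\<close> for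
  some \<open>w\<close> in \<open>F\<close>. Now \<open>x\<^sup>2 = (w y)\<^sup>2\<close> forces \<open>x = w y\<close> or \<open>x = - w y\<close>.\<close>
lemma square_injective_on_points:
  assumes "x \<noteq> 0" "y \<noteq> 0" "s \<noteq> 0" "x \<odot> x = s *s (y \<odot> y)"
  shows "\<exists>w. w \<noteq> 0 \<and> x = w *s y"
proof -
  define w where "w = nrm x / (s * nrm y)"
  have ny: "nrm y \<noteq> 0" "nrm x \<noteq> 0"
    using assms by (simp_all add: nrm_nonzero)
  have "nrm x ^ 2 = s ^ 3 * nrm y ^ 2"
    using arg_cong[OF assms(4), of nrm] by (simp add: nrm_mul nrm_smult power2_eq_square)
  then have w: "w ^ 2 = s"
    using ny assms(3) by (simp add: w_def field_simps power2_eq_square power3_eq_cube)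
  have "(x + w *s y) \<odot> (x - w *s y) = x \<odot> x - w ^ 2 *s (y \<odot> y)"
    by (simp add: vec_eq_iff forall_3 power2_eq_square algebra_simps)
  then have "(x + w *s y) \<odot> (x - w *s y) = 0"
    using assms(4) w by simp
  then have "x + w *s y = 0 \<or> x - w *s y = 0"
    by (rule mul_eq_0_imp)
  then have "x = (- w) *s y \<or> x = w *s y"
    by (auto simp: eq_neg_iff_add_eq_0)
  moreover have "w \<noteq> 0" "- w \<noteq> 0"
    using w assms(3) by auto
  ultimately show ?thesis
    by blast
qed

text \<open>Squaring induces an injective map from the finite set of points to itself, so that it is also
  surjective. In the proof the map is evaluated at a chosen representative of each point, which
  makes it unnecessary to discuss its independence of the representative.\<close>
lemma ex_square_on_point:
  assumes "g \<noteq> 0"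
  obtains e r where "e \<noteq> 0" "r \<noteq> 0" "e \<odot> e = r *s g"
proof -
  let ?P = "PG2_points :: ('a ^ 3) set set"
  have "\<exists>x. x \<noteq> 0 \<and> U = vec.span {x}" if "U \<in> ?P" for U
    using that by (metis PG2_points_span)
  then obtain b where b: "\<And>U. U \<in> ?P \<Longrightarrow> b U \<noteq> 0 \<and> U = vec.span {b U}"
    by metis
  define f where "f U = vec.span {b U \<odot> b U}" for U
  have nz: "b U \<odot> b U \<noteq> 0" if "U \<in> ?P" for U
    using that b mul_eq_0_imp by blast
  have "inj_on f ?P"
  proof
    fix U V assume UV: "U \<in> ?P" "V \<in> ?P" "f U = f V"
    then obtain s where "s \<noteq> 0" "b U \<odot> b U = s *s (b V \<odot> b V)"
      unfolding f_def using span_singleton_eq_iff[OF nz] by metis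
    then obtain w where "w \<noteq> 0" "b U = w *s b V"
      using square_injective_on_points UV b by metis
    then have "vec.span {b U} = vec.span {b V}"
      using span_singleton_eq_iff[of "b U" "b V"] b UV by metis
    then show "U = V"
      using b UV by simp
  qed
  moreover have "f ` ?P \<subseteq> ?P"
    using nz span_singleton_in_PG2_points by (auto simp: f_def)
  ultimately have "f ` ?P = ?P"
    by (intro endo_inj_surj) auto
  then obtain U where U: "U \<in> ?P" "f U = vec.span {g}"
    using span_singleton_in_PG2_points[OF assms] by (metis imageE)
  then obtain r where "r \<noteq> 0" "b U \<odot> b U = r *s g"
    unfolding f_def using span_singleton_eq_iff[OF nz] by metis
  with b U that show ?thesis
    by blast
qed

text \<open>Vectors with third coordinate zero are polynomials in \<open>t\<close> of degree at most one. Their products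
  involve no reduction and factor into linear polynomials over \<open>F\<close>, whereas \<open>e\<^sup>2\<close> is chosen
  proportional to the irreducible quadratic \<open>t\<^sup>2 + t - d\<close>.\<close>
lemma ex_square_not_product:
  obtains e where "e \<noteq> 0"
    "\<And>a b s. \<lbrakk>a $ 3 = 0; b $ 3 = 0; a \<odot> b = s *s (e \<odot> e)\<rbrakk> \<Longrightarrow> s = 0"
proof -
  obtain d where d: "\<And>x :: 'a. x ^ 2 + x \<noteq> d"
    using finite_ex_not_in_range[of "\<lambda>x :: 'a. x ^ 2 + x" 0 "- 1"] by auto
  define g :: "'a ^ 3" where "g = vector [- d, 1, 1]"
  have g: "r = 0" if "a $ 3 = 0" "b $ 3 = 0" "a \<odot> b = r *s g" for a b r
  proof (rule ccontr)
    assume r: "r \<noteq> 0"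
    have eqs: "a$1 * b$1 = - (r * d)" "a$1 * b$2 + a$2 * b$1 = r" "a$2 * b$2 = r"
      using that by (simp_all add: vec_eq_iff forall_3 g_def)
    then have nz: "a$2 \<noteq> 0" "b$2 \<noteq> 0"
      using r by auto
    \<comment> \<open>The linear factors \<open>t + u\<close> and \<open>t + v\<close> would give the quadratic the root \<open>- u\<close>.\<close>
    define u v where "u = a$1 / a$2" and "v = b$1 / b$2"
    have ab: "a$1 = u * a$2" "b$1 = v * b$2"
      using nz by (simp_all add: u_def v_def)
    have "r * (u * v) = a$1 * b$1" "r * (u + v) = a$1 * b$2 + a$2 * b$1"
      unfolding ab eqs(3)[symmetric] by (simp_all add: algebra_simps)
    then have "r * (u * v) = r * (- d)" "r * (u + v) = r * 1"
      using eqs(1,2) by simp_all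
    then have "u * v = - d" "u + v = 1"
      by (simp_all only: mult_left_cancel[OF r])
    moreover from this have "v = 1 - u"
      by (simp add: eq_diff_eq add.commute)
    ultimately have "u - u * u = - d"
      by (simp add: right_diff_distrib)
    then have "u * u - u = d"
      using minus_equation_iff[of "u - u * u"] by fastforce
    then have "(- u) ^ 2 + (- u) = d"
      by (simp add: power2_eq_square)
    with d show False
      by blast
  qed
  have "g \<noteq> 0"
    by (auto simp: vec_eq_iff forall_3 g_def)
  then obtain e r where e: "e \<noteq> 0" "r \<noteq> 0" "e \<odot> e = r *s g"
    by (rule ex_square_on_point)
  show ?thesis
  proof
    show "e \<noteq> 0" by fact
    fix a b s assume "a $ 3 = 0" "b $ 3 = 0" "a \<odot> b = s *s (e \<odot> e)"
    then have "s * r = 0"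
      using g[of a b "s * r"] e by (simp add: vector_smult_assoc)
    then show "s = 0"
      using e by simp
  qed
qed

section \<open>A harmonious coloring of the incidence graph\<close>

text \<open>The linear form that picks the third coordinate makes \<open>(z, y) \<mapsto> (z \<odot> y) $ 3\<close> a nondegenerate
  bilinear form, and a line is its own double orthogonal complement. A vector \<open>y\<close> orthogonal to
  both generators of the line exists by the pigeonhole principle, since \<open>F\<^sup>3\<close> does not inject
  into \<open>F\<^sup>2\<close>; dimensions then give equality.\<close>
lemma line_as_kernel:
  assumes "L \<in> PG2_lines"
  obtains y where "y \<noteq> 0" "L = {z. (z \<odot> y) $ 3 = 0}"
proof -
  have L: "vec.subspace L" "vec.dim L = 2"
    using assms by (auto simp: PG2_lines_def)
  obtain u v where uv: "L = vec.span {u, v}"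
    using assms by (rule PG2_lines_span)
  define f where "f y = ((u \<odot> y) $ 3, (v \<odot> y) $ 3)" for y
  have "\<not> inj f"
  proof
    assume "inj f"
    then have "CARD('a ^ 3) \<le> CARD('a \<times> 'a)"
      by (intro card_inj_on_le) auto
    then have "CARD('a) ^ 3 \<le> CARD('a) ^ 2"
      by (simp add: power2_eq_square)
    moreover have "CARD('a) \<ge> 2"
      using card_mono[of "UNIV :: 'a set" "{0, 1}"] by simp
    ultimately show False
      by (simp add: power_increasing_iff)
  qed
  then obtain y1 y2 where y12: "f y1 = f y2" "y1 \<noteq> y2"
    by (auto simp: inj_def)
  define y where "y = y1 - y2"
  define K where "K = {z. (z \<odot> y) $ 3 = 0}"
  have y: "y \<noteq> 0" "(u \<odot> y) $ 3 = 0" "(v \<odot> y) $ 3 = 0"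
    using y12 by (simp_all add: y_def f_def mul_diff_right del: mul_nth)
  have K: "vec.subspace K"
    unfolding vec.subspace_def K_def
    by (simp add: mul_add_left mul_smult_left del: mul_nth)
  have LK: "L \<subseteq> K"
    unfolding uv using y K by (intro vec.span_minimal) (auto simp: K_def)
  obtain z where "y \<odot> z = axis 3 1"
    using y(1) by (rule division)
  then have "z \<notin> K"
    by (simp add: K_def mul_commute[of z] del: mul_nth)
  then have "K \<subset> UNIV"
    by blast
  then have "vec.dim K < vec.dim (UNIV :: ('a ^ 3) set)"
    using K by (intro vec.dim_psubset) (simp add: vec.span_eq_iff[THEN iffD2])
  then have "vec.dim K < 3"
    by (simp only: vec_dim_card) simp
  then have "L = K"
    using L K LK by (intro vec.subspace_dim_equal) auto
  with y(1) that show ?thesis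
    by (simp add: K_def)
qed

text \<open>The point \<open>X l\<close> and the vector \<open>Y l\<close> chosen for a line \<open>l\<close> satisfy \<open>X l \<odot> Y l = e\<close>. The line
  takes its color from that point, that is, from \<open>e / Y l\<close>.\<close>
lemma ex_harmonious_coloring:
  "\<exists>f. harmonious_coloring
     (PG2_incidence_graph :: (('a ^ 3) set + ('a ^ 3) set) sgraph) (CARD('a)^2 + CARD('a) + 1) f"
proof -
  let ?P = "PG2_points :: ('a ^ 3) set set" and ?L = "PG2_lines :: ('a ^ 3) set set"
  let ?n = "CARD('a)^2 + CARD('a) + 1"
  obtain e where e: "e \<noteq> 0"
    "\<And>a b s. \<lbrakk>a $ 3 = 0; b $ 3 = 0; a \<odot> b = s *s (e \<odot> e)\<rbrakk> \<Longrightarrow> s = 0"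
    using ex_square_not_product by metis
  obtain k where k: "bij_betw k ?P {..<?n}"
    using ex_bij_betw_finite_nat[of ?P] by (auto simp: card_PG2_points atLeast0LessThan)
  have "\<exists>x y. x \<odot> y = e \<and> l = {z. (z \<odot> y) $ 3 = 0}" if "l \<in> ?L" for l
    using that by (metis line_as_kernel division mul_commute)
  then obtain X Y where XY: "\<And>l. l \<in> ?L \<Longrightarrow> X l \<odot> Y l = e \<and> l = {z. (z \<odot> Y l) $ 3 = 0}"
    by metis
  have X0: "X l \<noteq> 0" if "l \<in> ?L" for l
    using XY[OF that] e(1) by auto
  have line_cong: "l = m" if lm: "l \<in> ?L" "m \<in> ?L" "vec.span {X l} = vec.span {X m}" for l m
  proof -
    obtain s where s: "s \<noteq> 0" "X l = s *s X m"
      using lm span_singleton_eq_iff[OF X0] by metis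
    have "X m \<odot> Y m = X m \<odot> (s *s Y l)"
      using XY lm s by (metis mul_smult_left mul_smult_right)
    then have "Y m = s *s Y l"
      using mul_left_cancel X0 lm by blast
    then have "{z. (z \<odot> Y l) $ 3 = 0} = {z. (z \<odot> Y m) $ 3 = 0}"
      using s(1) by (simp add: mul_smult_right del: mul_nth)
    then show ?thesis
      using XY lm by metis
  qed
  \<comment> \<open>Two edges that exchange their colors: the products \<open>X m \<odot> Y l\<close> and \<open>X l \<odot> Y m\<close> lie in the
    kernel, and together they multiply to \<open>e \<odot> e\<close>.\<close>
  have cross: False
    if pl: "p \<in> ?P" "l \<in> ?L" "p \<subseteq> l" and qm: "p' \<in> ?P" "m \<in> ?L" "p' \<subseteq> m"
      and sw: "p = vec.span {X m}" "p' = vec.span {X l}" for p l p' m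
  proof -
    have inc: "(X m \<odot> Y l) $ 3 = 0" "(X l \<odot> Y m) $ 3 = 0"
      using pl qm sw XY vec.span_base[of _ "{_}"] by blast+
    have "(X m \<odot> Y l) \<odot> (X l \<odot> Y m) = (X m \<odot> Y m) \<odot> (X l \<odot> Y l)"
      by (simp only: mul_assoc mul_commute mul_left_commute)
    also have "\<dots> = 1 *s (e \<odot> e)"
      using XY pl qm by simp
    finally show False
      using e(2)[of "X m \<odot> Y l" "X l \<odot> Y m" 1] inc by (simp del: mul_nth)
  qed
  define f where "f = case_sum k (\<lambda>l. k (vec.span {X l}))"
  have f: "f (Inl p) = k p" "f (Inr l) = k (vec.span {X l})" for p l
    by (simp_all add: f_def)
  have kinj: "p = p'" if "k p = k p'" "p \<in> ?P" "p' \<in> ?P" for p p'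
    using k that by (auto simp: bij_betw_def inj_on_def)
  have XP: "vec.span {X l} \<in> ?P" if "l \<in> ?L" for l
    using X0[OF that] by (rule span_singleton_in_PG2_points)
  have kr: "k p < ?n" if "p \<in> ?P" for p
    using k that by (auto simp: bij_betw_def)
  \<comment> \<open>An edge with equal colors at its ends exchanges its colors with itself.\<close>
  have proper: "f (Inl p) \<noteq> f (Inr l)" if "p \<in> ?P" "l \<in> ?L" "p \<subseteq> l" for p l
    using cross[of p l p l] that kinj XP f by metis
  have "harmonious_coloring (PG2_incidence_graph :: (('a ^ 3) set + ('a ^ 3) set) sgraph) ?n f"
    unfolding harmonious_coloring_def proper_coloring_def
  proof (intro conjI allI impI ballI)
    show "f ` verts PG2_incidence_graph \<subseteq> {..<?n}"
      using kr XP by (auto simp: PG2_incidence_graph_def incidence_graph_def f)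
  next
    fix u v :: "('a ^ 3) set + ('a ^ 3) set"
    assume "{u, v} \<in> edges PG2_incidence_graph"
    then show "f u \<noteq> f v"
      using proper
      by (fastforce simp: PG2_incidence_graph_def incidence_graph_def doubleton_eq_iff)
  next
    fix E F :: "(('a ^ 3) set + ('a ^ 3) set) set"
    assume "E \<in> edges PG2_incidence_graph" "F \<in> edges PG2_incidence_graph"
      and fEF: "f ` E = f ` F"
    then obtain p l p' m where
      E: "E = {Inl p, Inr l}" "p \<in> ?P" "l \<in> ?L" "p \<subseteq> l" and
      F: "F = {Inl p', Inr m}" "p' \<in> ?P" "m \<in> ?L" "p' \<subseteq> m"
      unfolding PG2_incidence_graph_def incidence_graph_def by auto
    have "{k p, k (vec.span {X l})} = {k p', k (vec.span {X m})}"
      using fEF by (simp add: E(1) F(1) f)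
    then consider "p = p'" "vec.span {X l} = vec.span {X m}"
      | "p = vec.span {X m}" "p' = vec.span {X l}"
      using kinj XP E F by (metis doubleton_eq_iff)
    then show "E = F"
    proof cases
      case 1
      then show ?thesis
        using line_cong E F by metis
    next
      case 2
      then show ?thesis
        using cross E F by metis
    qed
  qed
  then show ?thesis
    by blast
qed

end

section \<open>The harmonious chromatic number\<close>

text \<open>Two points of the same color would put the same pair of colors on their edges to the line that
  joins them.\<close>
lemma harmonious_coloring_PG2_ge:
  assumes "harmonious_coloring
    (PG2_incidence_graph :: (('a::{field,finite} ^ 3) set + ('a ^ 3) set) sgraph) k f"
  shows "CARD('a)^2 + CARD('a) + 1 \<le> k"
proof -
  let ?G = "PG2_incidence_graph :: (('a ^ 3) set + ('a ^ 3) set) sgraph"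
  let ?P = "PG2_points :: ('a ^ 3) set set"
  have edge: "{Inl p, Inr l} \<in> edges ?G" if "p \<in> ?P" "l \<in> PG2_lines" "p \<subseteq> l" for p l
    using that by (auto simp: PG2_incidence_graph_def incidence_graph_def)
  have "inj_on (\<lambda>p. f (Inl p)) ?P"
  proof (rule inj_onI, rule ccontr)
    fix p p' assume p: "p \<in> ?P" "p' \<in> ?P" "f (Inl p) = f (Inl p')" "p \<noteq> p'"
    obtain l where l: "l \<in> PG2_lines" "p \<subseteq> l" "p' \<subseteq> l"
      using p(1,2,4) by (rule two_points_on_line)
    have "f ` {Inl p, Inr l} = f ` {Inl p', Inr l}"
      using p(3) by simp
    then have "{Inl p, Inr l} = {Inl p', Inr l :: ('a ^ 3) set + ('a ^ 3) set}"
      using assms edge p l unfolding harmonious_coloring_def by blast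
    with p(4) show False
      by (auto simp: doubleton_eq_iff)
  qed
  moreover have "(\<lambda>p. f (Inl p)) ` ?P \<subseteq> {..<k}"
    using assms
    by (auto simp: harmonious_coloring_def proper_coloring_def
        PG2_incidence_graph_def incidence_graph_def)
  ultimately have "card ?P \<le> card {..<k}"
    by (intro card_inj_on_le) auto
  then show ?thesis
    by (simp add: card_PG2_points)
qed

lemma harmonious_number_PG2:
  "harmonious_number (PG2_incidence_graph :: (('a::{field,finite} ^ 3) set + ('a ^ 3) set) sgraph)
     = CARD('a)^2 + CARD('a) + 1"
proof -
  obtain c :: 'a where "\<And>x. x ^ 3 - x ^ 2 \<noteq> c"
    using finite_ex_not_in_range[of "\<lambda>x :: 'a. x ^ 3 - x ^ 2" 0 1] by auto
  then interpret cubic_extension c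
    by unfold_locales
  show ?thesis
    unfolding harmonious_number_def
    using ex_harmonious_coloring harmonious_coloring_PG2_ge by (intro Least_equality) blast+
qed

theorem theorem9:
  fixes q :: nat
    and G :: "(('a::{field,finite} ^ 3) set + ('a ^ 3) set) sgraph"
  assumes "primepow q" and "odd q"
    and "CARD('a) = q"
    and "G = PG2_incidence_graph"
  shows "q^2 + q + 1 \<le> harmonious_number G \<and> harmonious_number G \<le> q^2 + q + 2"
  using assms harmonious_number_PG2[where 'a = 'a] by simp

end
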